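(* Let $H$ be an adjacency $k$-resolved graph of order $n_2$ and let $G$ be a non-trivial connected graph of order $n_1$, having $t_1$ true twin equivalence classes and diameter $D(G)<k$. If $\dim_l(G)=n_1-t_1$, then $\dim_l(G\boxtimes H)= n_2(n_1-t_1)$.
   Context: All graphs are finite, simple and connected; $d_G$ is shortest-path distance and $D(G)$ the diameter. Two vertices $u,v$ are true twins if $N_G[u]=N_G[v]$; the true twin equivalence classes are the classes of the relation $N_G[x]=N_G[y]$. A set $S$ is a local metric generator for $G$ if for every two adjacent vertices $x,y$ there is $s\in S$ with $d_G(s,x)\ne d_G(s,y)$; $\dim_l(G)$ is the minimum cardinality of a local metric generator. The strong product $G\boxtimes H$ has vertex set $V(G)\times V(H)$, with $(a,b)\sim(c,d)$ iff ($a=c$ and $b\sim d$) or ($b=d$ and $a\sim c$) or ($a\sim c$ and $b\sim d$). The interval $I[x,y]$ is the set of vertices on some shortest $x$–$y$ path. $H$ is adjacency $k$-resolved if for every two adjacent vertices $x,y$ of $H$ there is $w$ with ($d_H(y,w)\ge k$ and $x\in I[y,w]$) or ($d_H(x,w)\ge k$ and $y\in I[x,w]$). *)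

theory Defs
  imports "Graph_Theory.Graph_Theory"
begin

text \<open>
  Finite simple graphs are the symmetric loop-free finite digraphs \<open>pair_graph\<close>, where every edge
  is represented by its two arcs. The predicate \<open>Digraph_Component.connected\<close> excludes the graph
  without vertices.
\<close>

text \<open>
  Natural-number valued, hence only meaningful for vertices joined by a path;
  it then agrees with the extended real valued library distance for unit weights, see below.
\<close>
definition gdist :: "'a pair_pre_digraph \<Rightarrow> 'a \<Rightarrow> 'a \<Rightarrow> nat" where
  "gdist G u v = (LEAST n. \<exists>p. pre_digraph.apath (with_proj G) u p v \<and> length p = n)"

definition diameter :: "'a pair_pre_digraph \<Rightarrow> nat" where
  "diameter G = Max {gdist G u v | u v. u \<in> pverts G \<and> v \<in> pverts G}"

definition interval :: "'a pair_pre_digraph \<Rightarrow> 'a \<Rightarrow> 'a \<Rightarrow> 'a set" where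
  "interval G x y = {v. \<exists>p. pre_digraph.apath (with_proj G) x p y \<and> length p = gdist G x y
     \<and> v \<in> set (pawalk_verts x p)}"

definition closed_nbhd :: "'a pair_pre_digraph \<Rightarrow> 'a \<Rightarrow> 'a set" where
  "closed_nbhd G v = insert v {u. v \<rightarrow>\<^bsub>G\<^esub> u}"

definition true_twin_rel :: "'a pair_pre_digraph \<Rightarrow> 'a rel" where
  "true_twin_rel G = {(x, y). x \<in> pverts G \<and> y \<in> pverts G \<and> closed_nbhd G x = closed_nbhd G y}"

definition true_twin_classes :: "'a pair_pre_digraph \<Rightarrow> 'a set set" where
  "true_twin_classes G = pverts G // true_twin_rel G"

definition local_metric_generator :: "'a pair_pre_digraph \<Rightarrow> 'a set \<Rightarrow> bool" where
  "local_metric_generator G S \<longleftrightarrow> S \<subseteq> pverts G \<and>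
     (\<forall>x y. x \<rightarrow>\<^bsub>G\<^esub> y \<longrightarrow> (\<exists>s\<in>S. gdist G s x \<noteq> gdist G s y))"

definition local_metric_dim :: "'a pair_pre_digraph \<Rightarrow> nat" where
  "local_metric_dim G = (LEAST n. \<exists>S. local_metric_generator G S \<and> card S = n)"

definition strong_product ::
  "'a pair_pre_digraph \<Rightarrow> 'b pair_pre_digraph \<Rightarrow> ('a \<times> 'b) pair_pre_digraph" where
  "strong_product G H =
     \<lparr> pverts = pverts G \<times> pverts H,
       parcs = {((a, b), (c, d)). (a, b) \<in> pverts G \<times> pverts H \<and> (c, d) \<in> pverts G \<times> pverts H \<and>
         ((a = c \<and> b \<rightarrow>\<^bsub>H\<^esub> d) \<or> (b = d \<and> a \<rightarrow>\<^bsub>G\<^esub> c) \<or> (a \<rightarrow>\<^bsub>G\<^esub> c \<and> b \<rightarrow>\<^bsub>H\<^esub> d))} \<rparr>"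

definition adjacency_resolved :: "nat \<Rightarrow> 'a pair_pre_digraph \<Rightarrow> bool" where
  "adjacency_resolved k H \<longleftrightarrow>
     (\<forall>x y. x \<rightarrow>\<^bsub>H\<^esub> y \<longrightarrow>
        (\<exists>w\<in>pverts H. (gdist H y w \<ge> k \<and> x \<in> interval H y w) \<or>
                      (gdist H x w \<ge> k \<and> y \<in> interval H x w)))"

lemma (in pair_wf_digraph) gdist_eq_shortest_path:
  assumes "u \<rightarrow>\<^sup>*\<^bsub>G\<^esub> v"
  shows "ereal (real (gdist G u v)) = \<mu> (\<lambda>_. 1) u v"
proof -
  have cost: "awalk_cost (\<lambda>_. 1) p = real (length p)" for p :: "('a \<times> 'a) awalk"
    by (induct p) (auto simp: awalk_cost_def)
  from assms obtain p0 where "apath u p0 v"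
    using reachable_apath by blast
  then have ex: "\<exists>p. apath u p v \<and> length p = length p0"
    by blast
  obtain p where p: "apath u p v" "length p = gdist G u v"
    using LeastI[where P = "\<lambda>n. \<exists>p. apath u p v \<and> length p = n", OF ex]
    unfolding gdist_def by blast
  have least: "gdist G u v \<le> length q" if "apath u q v" for q
    unfolding gdist_def by (rule Least_le) (use that in blast)
  have "ereal (real (gdist G u v)) \<le> ereal (awalk_cost (\<lambda>_. 1) q)" if "awalk u q v" for q
  proof -
    have "apath u (awalk_to_apath q) v"
      using that by (rule apath_awalk_to_apath)
    then have "gdist G u v \<le> length (awalk_to_apath q)"
      by (rule least)
    also have "\<dots> \<le> length q"
      using awalk_to_path_no_neg_cyc_cost[OF that, of "\<lambda>_. 1"] by (simp add: cost)
    finally show ?thesis by (simp add: cost)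
  qed
  then have "ereal (real (gdist G u v)) \<le> \<mu> (\<lambda>_. 1) u v"
    unfolding \<mu>_def by (auto intro: INF_greatest)
  moreover have "\<mu> (\<lambda>_. 1) u v \<le> ereal (real (gdist G u v))"
    using min_cost_le_walk_cost[of u p v "\<lambda>_. 1"] p cost[of p] by (auto intro: awalkI_apath)
  ultimately show ?thesis by (rule antisym)
qed

lemma card_true_twin_classes_le:
  assumes "finite (pverts G)"
  shows "card (true_twin_classes G) \<le> card (pverts G)"
proof -
  have "true_twin_classes G = (\<lambda>x. true_twin_rel G `` {x}) ` pverts G"
    by (auto simp: true_twin_classes_def quotient_def)
  then show ?thesis using assms by (simp add: card_image_le)
qed

lemma pair_graph_strong_product:
  assumes "pair_graph G" "pair_graph H"
  shows "pair_graph (strong_product G H)"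
proof -
  interpret G: pair_graph G by fact
  interpret H: pair_graph H by fact
  have fin: "finite (pverts (strong_product G H))"
    by (simp add: strong_product_def)
  have sub: "parcs (strong_product G H) \<subseteq> pverts (strong_product G H) \<times> pverts (strong_product G H)"
    by (auto simp: strong_product_def)
  have fina: "finite (parcs (strong_product G H))"
    using finite_subset[OF sub] fin by blast
  have sy: "sym (parcs (strong_product G H))"
    using G.sym_arcs H.sym_arcs
    by (auto simp: strong_product_def symmetric_def sym_def)
  have lf: "fst e \<noteq> snd e" if "e \<in> parcs (strong_product G H)" for e
    using that G.pair_no_loops H.pair_no_loops
    by (fastforce simp: strong_product_def)
  show ?thesis
    by unfold_locales (use fin fina sub sy lf in \<open>auto simp: symmetric_def\<close>)
qed

end

theory Submission
  imports Defs
begin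

text \<open>
  The closed ball of radius \<open>n\<close> around \<open>u\<close> is the image of \<open>u\<close> under the \<open>n\<close>-th power of the
  reflexive closure of the adjacency relation, and the reflexive closure for \<open>G \<boxtimes> H\<close> is the product
  of those for \<open>G\<close> and \<open>H\<close>. Hence distances in \<open>G \<boxtimes> H\<close> are maxima of the distances in the factors.

  Upper bound: if \<open>S\<close> is a local metric basis of \<open>G\<close>, then \<open>S \<times> V(H)\<close> resolves all edges. For an edge
  \<open>(a, b) (c, b)\<close> use \<open>(s, b)\<close> with \<open>s\<close> resolving \<open>a c\<close>. For \<open>b \<noteq> d\<close> the edge \<open>(a, b) (c, d)\<close> is
  resolved by \<open>(s, w)\<close> for every \<open>s\<close>, where \<open>w\<close> comes from adjacency resolvability: the larger of the
  distances of \<open>w\<close> to \<open>b\<close> and \<open>d\<close> is at least \<open>k > D(G)\<close>, so it dominates the first coordinate.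

  Lower bound: true twins are resolved by themselves only, so a local metric generator omits at most
  one vertex of each set \<open>C \<times> {b}\<close> with \<open>C\<close> a true twin class of \<open>G\<close>.
\<close>

section \<open>Distances, balls and true twins in a single graph\<close>

context pair_graph
begin

lemma parcs_sym: "(u, v) \<in> parcs G \<Longrightarrow> (v, u) \<in> parcs G"
  using graph_symmetric by simp

text \<open>A step of the reflexive closure may stay in place, so the exponent only bounds the
  length of the walk. In a product this lets walks of different lengths in the factors run in
  parallel.\<close>

lemma relpow_reflcl_iff_awalk:
  assumes "u \<in> pverts G"
  shows "(u, v) \<in> (parcs G)\<^sup>= ^^ n \<longleftrightarrow> (\<exists>p. awalk u p v \<and> length p \<le> n)"
proof
  show "(u, v) \<in> (parcs G)\<^sup>= ^^ n \<Longrightarrow> \<exists>p. awalk u p v \<and> length p \<le> n"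
  proof (induction n arbitrary: v)
    case 0
    then show ?case using assms by (auto intro!: exI[of _ "[]"] simp: awalk_Nil_iff)
  next
    case (Suc n)
    then obtain x where x: "(u, x) \<in> (parcs G)\<^sup>= ^^ n" "(x, v) \<in> (parcs G)\<^sup>="
      by auto
    then obtain p where p: "awalk u p x" "length p \<le> n" using Suc.IH by blast
    show ?case
    proof (cases "x = v")
      case True
      then show ?thesis using p le_SucI by blast
    next
      case False
      then have "(x, v) \<in> parcs G" using x by auto
      then have "awalk x [(x, v)] v" using wellformed(2)[of "(x, v)"]
        by (simp add: awalk_Cons_iff awalk_Nil_iff)
      then have "awalk u (p @ [(x, v)]) v" using p by auto
      then show ?thesis using p by (intro exI[of _ "p @ [(x, v)]"]) simp
    qed
  qed
next
  have "awalk u p v \<Longrightarrow> length p \<le> n \<Longrightarrow> (u, v) \<in> (parcs G)\<^sup>= ^^ n" for p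
  proof (induction p arbitrary: u n)
    case Nil
    have "(v, v) \<in> (parcs G)\<^sup>= ^^ n" by (induction n) auto
    then show ?case using Nil by (simp add: awalk_Nil_iff)
  next
    case (Cons e p)
    then obtain m where m: "n = Suc m" "length p \<le> m" by (cases n) auto
    from Cons.prems have "e \<in> parcs G" "u = fst e" "awalk (snd e) p v"
      by (auto simp: awalk_Cons_iff)
    then have "(u, snd e) \<in> (parcs G)\<^sup>=" "(snd e, v) \<in> (parcs G)\<^sup>= ^^ m"
      using Cons.IH m by auto
    then show ?case unfolding m(1) by (rule relpow_Suc_I2)
  qed
  then show "\<exists>p. awalk u p v \<and> length p \<le> n \<Longrightarrow> (u, v) \<in> (parcs G)\<^sup>= ^^ n" by blast
qed

text \<open>\<open>gdist\<close> minimises over paths only. Deleting the cycles of a walk does not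
  lengthen it, because under unit weights no cycle has negative cost.\<close>

lemma gdist_le_awalk:
  assumes "awalk u p v"
  shows "gdist G u v \<le> length p"
proof -
  have "gdist G u v \<le> length (awalk_to_apath p)"
    unfolding gdist_def by (rule Least_le) (use apath_awalk_to_apath[OF assms] in blast)
  also have "\<dots> \<le> length p"
  proof -
    have cost: "awalk_cost (\<lambda>_. 1) q = real (length q)" for q :: "('a \<times> 'a) awalk"
      by (induct q) (auto simp: awalk_cost_def)
    show ?thesis
      using awalk_to_path_no_neg_cyc_cost[OF assms, of "\<lambda>_. 1"] by (simp add: cost)
  qed
  finally show ?thesis .
qed

text \<open>Reachability guarantees that the minimum in \<open>gdist\<close> is attained, so a
  shortest path lies in the ball; conversely every walk bounds the distance.\<close>

lemma gdist_le_iff: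
  assumes "u \<rightarrow>\<^sup>*\<^bsub>G\<^esub> v"
  shows "gdist G u v \<le> n \<longleftrightarrow> (u, v) \<in> (parcs G)\<^sup>= ^^ n"
proof -
  from assms obtain p0 where "apath u p0 v" using reachable_apath by blast
  then have "\<exists>p. apath u p v \<and> length p = length p0" by blast
  then obtain p where p: "apath u p v" "length p = gdist G u v"
    using LeastI[where P = "\<lambda>n. \<exists>p. apath u p v \<and> length p = n"] unfolding gdist_def by blast
  have "u \<in> pverts G" using assms reachable_in_verts by auto
  show ?thesis
    unfolding relpow_reflcl_iff_awalk[OF \<open>u \<in> pverts G\<close>]
    using p gdist_le_awalk by (metis awalkI_apath order_trans)
qed

lemma gdist_self: "u \<in> pverts G \<Longrightarrow> gdist G u u = 0"
  using gdist_le_iff[of u u 0] by auto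

lemma gdist_eq_0_iff: "u \<rightarrow>\<^sup>*\<^bsub>G\<^esub> v \<Longrightarrow> gdist G u v = 0 \<longleftrightarrow> u = v"
  using gdist_le_iff[of u v 0] by auto

text \<open>Symmetry of the arcs passes to all powers of the reflexive closure, so both distances
  satisfy the same upper bounds.\<close>

lemma gdist_commute:
  assumes "u \<rightarrow>\<^sup>*\<^bsub>G\<^esub> v"
  shows "gdist G u v = gdist G v u"
proof -
  have "((parcs G)\<^sup>=)\<inverse> = (parcs G)\<^sup>="
    using parcs_sym by auto
  then have "((parcs G)\<^sup>= ^^ n)\<inverse> = (parcs G)\<^sup>= ^^ n" for n
    by (induction n) (simp_all only: relpow.simps converse_relcomp converse_Id relpow_commute)
  then have "(u, v) \<in> (parcs G)\<^sup>= ^^ n \<longleftrightarrow> (v, u) \<in> (parcs G)\<^sup>= ^^ n" for n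
    by blast
  moreover have "v \<rightarrow>\<^sup>*\<^bsub>G\<^esub> u"
    using assms by (rule symmetric_reachable')
  ultimately have "gdist G u v \<le> n \<longleftrightarrow> gdist G v u \<le> n" for n
    using gdist_le_iff assms by blast
  then show ?thesis by (meson order_refl order_antisym)
qed

text \<open>Cut a shortest path from \<open>y\<close> to \<open>w\<close> at \<open>x\<close>: the
  part before \<open>x\<close> is non-empty, and the rest is a walk from \<open>x\<close> to
  \<open>w\<close>.\<close>

lemma gdist_less_if_interval:
  assumes "x \<in> interval G y w" and "x \<noteq> y"
  shows "gdist G x w < gdist G y w"
proof -
  obtain p where p: "apath y p w" "length p = gdist G y w" "x \<in> set (awalk_verts y p)"
    using assms unfolding interval_def by auto
  then obtain q r where qr: "p = q @ r" "awalk y q x" "awalk x r w"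
    using awalk_decomp[of y p w x] by (metis awalkI_apath)
  have "q \<noteq> []" using qr assms by (auto simp: awalk_Nil_iff)
  then show ?thesis using p qr gdist_le_awalk[OF qr(3)] by (cases q) auto
qed

text \<open>As \<open>s\<close> differs from \<open>x\<close>, a shortest walk to \<open>x\<close>
  has a last step. It starts in the common closed neighbourhood, so it can be redirected to
  \<open>y\<close>.\<close>

lemma gdist_true_twins_le:
  assumes "s \<rightarrow>\<^sup>*\<^bsub>G\<^esub> x" "s \<rightarrow>\<^sup>*\<^bsub>G\<^esub> y" "closed_nbhd G x = closed_nbhd G y" "s \<noteq> x"
  shows "gdist G s y \<le> gdist G s x"
proof -
  obtain m where m: "gdist G s x = Suc m"
    using gdist_eq_0_iff assms by (cases "gdist G s x") auto
  then obtain u where u: "(s, u) \<in> (parcs G)\<^sup>= ^^ m" "(u, x) \<in> (parcs G)\<^sup>="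
    using gdist_le_iff[of s x "Suc m"] assms by auto
  then have "u \<in> closed_nbhd G x"
    using parcs_sym by (auto simp: closed_nbhd_def)
  then have "(u, y) \<in> (parcs G)\<^sup>="
    unfolding assms(3) using parcs_sym by (auto simp: closed_nbhd_def)
  then show ?thesis using u assms m by (auto simp: gdist_le_iff)
qed

lemma reachable_if_connected:
  assumes "Digraph_Component.connected G" "u \<in> pverts G" "v \<in> pverts G"
  shows "u \<rightarrow>\<^sup>*\<^bsub>G\<^esub> v"
  using symmetric_connected_imp_strongly_connected[OF sym_arcs] assms by auto

lemma true_twins_resolved_only_by_themselves:
  assumes "s \<rightarrow>\<^sup>*\<^bsub>G\<^esub> x" "s \<rightarrow>\<^sup>*\<^bsub>G\<^esub> y" "closed_nbhd G x = closed_nbhd G y"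
    and "gdist G s x \<noteq> gdist G s y"
  shows "s = x \<or> s = y"
  using gdist_true_twins_le assms by (metis order_antisym)

lemma gdist_le_diameter:
  assumes "u \<in> pverts G" "v \<in> pverts G"
  shows "gdist G u v \<le> diameter G"
proof -
  have "{gdist G u v | u v. u \<in> pverts G \<and> v \<in> pverts G}
      = (\<lambda>(u, v). gdist G u v) ` (pverts G \<times> pverts G)" by auto
  then have "finite {gdist G u v | u v. u \<in> pverts G \<and> v \<in> pverts G}" by simp
  then show ?thesis unfolding diameter_def by (rule Max_ge) (use assms in blast)
qed

text \<open>The set of all vertices is a generator, since each end of an edge resolves it; hence the
  minimum is attained.\<close>

lemma obtain_local_metric_basis:
  assumes "Digraph_Component.connected G"
  obtains S where "local_metric_generator G S" "card S = local_metric_dim G"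
proof -
  have "local_metric_generator G (pverts G)"
    unfolding local_metric_generator_def
  proof (intro conjI allI impI)
    fix x y assume "x \<rightarrow>\<^bsub>G\<^esub> y"
    then have xy: "x \<in> pverts G" "y \<in> pverts G" "x \<noteq> y"
      using wellformed[of "(x, y)"] pair_no_loops[of "(x, y)"] by auto
    then have "gdist G x x \<noteq> gdist G x y"
      using gdist_eq_0_iff reachable_if_connected[OF assms] by (metis gdist_self)
    then show "\<exists>s\<in>pverts G. gdist G s x \<noteq> gdist G s y" using xy by blast
  qed simp
  then have "\<exists>S. local_metric_generator G S \<and> card S = card (pverts G)" by blast
  then show thesis
    using LeastI[where P = "\<lambda>n. \<exists>S. local_metric_generator G S \<and> card S = n"] that
    unfolding local_metric_dim_def by blast
qed

text \<open>Two vertices and connectedness yield an edge, which some member of \<open>S\<close> must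
  resolve.\<close>

lemma local_metric_generator_nonempty:
  assumes "Digraph_Component.connected G" "card (pverts G) \<ge> 2" "local_metric_generator G S"
  shows "S \<noteq> {}"
proof -
  obtain x y where "x \<in> pverts G" "y \<in> pverts G" "x \<noteq> y"
    using assms(2) by (metis card_le_Suc0_iff_eq finite_verts not_less_eq_eq numeral_2_eq_2 with_proj_simps(1))
  then have "x \<rightarrow>\<^sup>*\<^bsub>G\<^esub> y" using reachable_if_connected assms by blast
  then obtain z where "x \<rightarrow>\<^bsub>G\<^esub> z"
    using \<open>x \<noteq> y\<close> by (auto elim: converse_reachable_cases)
  then show ?thesis using assms(3) unfolding local_metric_generator_def by blast
qed

end

lemma local_metric_dim_le: "local_metric_generator G S \<Longrightarrow> local_metric_dim G \<le> card S"
  unfolding local_metric_dim_def by (rule Least_le) blast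

lemma closed_nbhd_eq_if_true_twin_class_eq:
  assumes "x \<in> pverts G" "true_twin_rel G `` {x} = true_twin_rel G `` {y}"
  shows "closed_nbhd G x = closed_nbhd G y"
proof -
  have "x \<in> true_twin_rel G `` {x}" using assms(1) by (simp add: true_twin_rel_def)
  then have "x \<in> true_twin_rel G `` {y}" by (simp only: assms(2))
  then show ?thesis by (simp add: true_twin_rel_def)
qed

section \<open>The strong product of two connected graphs and its distances\<close>

locale strong_product_graphs = G: pair_graph G + H: pair_graph H
  for G :: "'a pair_pre_digraph" and H :: "'b pair_pre_digraph" +
  assumes connected_G: "Digraph_Component.connected G"
    and connected_H: "Digraph_Component.connected H"
begin

abbreviation P :: "('a \<times> 'b) pair_pre_digraph" where
  "P \<equiv> strong_product G H"

sublocale P: pair_graph P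
  by (rule pair_graph_strong_product) unfold_locales

lemma pverts_P: "pverts P = pverts G \<times> pverts H"
  by (simp add: strong_product_def)

text \<open>The three kinds of adjacency together with equality are the four ways in which each
  coordinate stays or moves along an edge.\<close>

lemma reflcl_parcs_P_iff:
  assumes "a \<in> pverts G" "b \<in> pverts H" "c \<in> pverts G" "d \<in> pverts H"
  shows "((a, b), (c, d)) \<in> (parcs P)\<^sup>= \<longleftrightarrow> (a, c) \<in> (parcs G)\<^sup>= \<and> (b, d) \<in> (parcs H)\<^sup>="
  using assms by (auto simp: strong_product_def)

lemma relpow_reflcl_parcs_P_iff:
  assumes "a \<in> pverts G" "b \<in> pverts H" "c \<in> pverts G" "d \<in> pverts H"
  shows "((a, b), (c, d)) \<in> (parcs P)\<^sup>= ^^ n \<longleftrightarrow>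
    (a, c) \<in> (parcs G)\<^sup>= ^^ n \<and> (b, d) \<in> (parcs H)\<^sup>= ^^ n"
  using assms
proof (induction n arbitrary: c d)
  case 0
  then show ?case by auto
next
  case (Suc n)
  show ?case
  proof
    assume "((a, b), (c, d)) \<in> (parcs P)\<^sup>= ^^ Suc n"
    then obtain x y where xy: "((a, b), (x, y)) \<in> (parcs P)\<^sup>= ^^ n" "((x, y), (c, d)) \<in> (parcs P)\<^sup>="
      by auto
    have "x \<in> pverts G" "y \<in> pverts H"
      using xy(2) P.wellformed(1)[of "((x, y), (c, d))"] Suc.prems by (auto simp: pverts_P)
    then show "(a, c) \<in> (parcs G)\<^sup>= ^^ Suc n \<and> (b, d) \<in> (parcs H)\<^sup>= ^^ Suc n"
      using xy Suc reflcl_parcs_P_iff[of x y c d] by (auto simp del: Un_iff)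
  next
    assume "(a, c) \<in> (parcs G)\<^sup>= ^^ Suc n \<and> (b, d) \<in> (parcs H)\<^sup>= ^^ Suc n"
    then obtain x y where xy: "(a, x) \<in> (parcs G)\<^sup>= ^^ n" "(x, c) \<in> (parcs G)\<^sup>="
      "(b, y) \<in> (parcs H)\<^sup>= ^^ n" "(y, d) \<in> (parcs H)\<^sup>=" by auto
    have "x \<in> pverts G" "y \<in> pverts H"
      using xy G.wellformed(1)[of "(x, c)"] H.wellformed(1)[of "(y, d)"] Suc.prems by auto
    then have "((a, b), (x, y)) \<in> (parcs P)\<^sup>= ^^ n" "((x, y), (c, d)) \<in> (parcs P)\<^sup>="
      using xy Suc reflcl_parcs_P_iff[of x y c d] by auto
    then show "((a, b), (c, d)) \<in> (parcs P)\<^sup>= ^^ Suc n" by (rule relpow_Suc_I)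
  qed
qed

context
  fixes a b c d
  assumes verts: "a \<in> pverts G" "b \<in> pverts H" "c \<in> pverts G" "d \<in> pverts H"
begin

text \<open>Phrased with powers instead of \<open>gdist P\<close> because reachability in
  \<open>P\<close>, which \<open>P.gdist_le_iff\<close> presupposes, is itself derived from it by
  taking \<open>n\<close> to be the maximum.\<close>

lemma relpow_reflcl_parcs_P_iff_max:
  "((a, b), (c, d)) \<in> (parcs P)\<^sup>= ^^ n \<longleftrightarrow> max (gdist G a c) (gdist H b d) \<le> n"
  using verts G.reachable_if_connected[OF connected_G] H.reachable_if_connected[OF connected_H]
  by (simp add: relpow_reflcl_parcs_P_iff G.gdist_le_iff H.gdist_le_iff)

lemma reachable_strong_product: "(a, b) \<rightarrow>\<^sup>*\<^bsub>P\<^esub> (c, d)"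
proof -
  have "(a, b) \<in> pverts P" using verts by (simp add: pverts_P)
  then show ?thesis
    using relpow_reflcl_parcs_P_iff_max P.relpow_reflcl_iff_awalk P.reachable_awalk by blast
qed

lemma gdist_strong_product: "gdist P (a, b) (c, d) = max (gdist G a c) (gdist H b d)"
  using P.gdist_le_iff[OF reachable_strong_product] relpow_reflcl_parcs_P_iff_max
  by (meson order_refl order_antisym)

end

lemma connected_strong_product: "Digraph_Component.connected P"
proof (rule P.connectedI)
  show "pverts P \<noteq> {}" using connected_G connected_H
    by (auto simp: pverts_P connected_def strongly_connected_def)
next
  fix u v assume "u \<in> pverts P" "v \<in> pverts P"
  then have "u \<rightarrow>\<^sup>*\<^bsub>P\<^esub> v"
    by (cases u, cases v) (simp add: pverts_P reachable_strong_product)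
  then show "u \<rightarrow>\<^sup>*\<^bsub>mk_symmetric P\<^esub> v" by (rule P.reachable_mk_symmetricI)
qed

text \<open>Lifts true twins \<open>a\<close>, \<open>c\<close> of \<open>G\<close> to true twins
  \<open>(a, b)\<close>, \<open>(c, b)\<close> of the product.\<close>

lemma closed_nbhd_strong_product:
  assumes "a \<in> pverts G" "b \<in> pverts H"
  shows "closed_nbhd P (a, b) = closed_nbhd G a \<times> closed_nbhd H b"
proof -
  have "c \<in> pverts G" if "(a, c) \<in> parcs G" for c using G.wellformed(2)[OF that] by simp
  moreover have "d \<in> pverts H" if "(b, d) \<in> parcs H" for d using H.wellformed(2)[OF that] by simp
  ultimately show ?thesis using assms by (auto simp: closed_nbhd_def strong_product_def)
qed

section \<open>Upper bound\<close>

lemma local_metric_generator_Times: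
  assumes S: "local_metric_generator G S" "S \<noteq> {}"
    and k: "diameter G < k" "adjacency_resolved k H"
  shows "local_metric_generator P (S \<times> pverts H)"
proof -
  have SG: "S \<subseteq> pverts G" using S by (simp add: local_metric_generator_def)
  \<comment> \<open>At \<open>(c, d)\<close> the maximum equals the distance from \<open>d\<close>
    to \<open>w\<close>. At \<open>(a, b)\<close> both entries are strictly smaller: the first is
    below \<open>k\<close>, the second by the interval condition.\<close>
  have resolve: "gdist P (s, w) (a, b) \<noteq> gdist P (s, w) (c, d)"
    if "s \<in> S" "w \<in> pverts H" "a \<in> pverts G" "b \<in> pverts H" "c \<in> pverts G" "d \<in> pverts H"
      "b \<noteq> d" "gdist H d w \<ge> k" "b \<in> interval H d w" for s w a b c d
  proof -
    have "gdist H b w < gdist H d w" using that by (auto intro: H.gdist_less_if_interval)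
    moreover have "gdist H b w = gdist H w b" "gdist H d w = gdist H w d"
      using that H.gdist_commute H.reachable_if_connected[OF connected_H] by auto
    moreover have "gdist G s a < k" "gdist G s c < k"
      using that SG G.gdist_le_diameter k(1) by (meson in_mono le_less_trans)+
    ultimately show ?thesis using that SG by (auto simp: gdist_strong_product subset_iff)
  qed
  have "\<exists>s\<in>S \<times> pverts H. gdist P s (a, b) \<noteq> gdist P s (c, d)"
    if adj: "(a, b) \<rightarrow>\<^bsub>P\<^esub> (c, d)" for a b c d
  proof -
    have v: "a \<in> pverts G" "b \<in> pverts H" "c \<in> pverts G" "d \<in> pverts H"
      using adj by (auto simp: strong_product_def)
    show ?thesis
    proof (cases "b = d")
      case True
      then have "a \<rightarrow>\<^bsub>G\<^esub> c"
        using adj H.pair_no_loops by (fastforce simp: strong_product_def)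
      then obtain s where s: "s \<in> S" "gdist G s a \<noteq> gdist G s c"
        using S unfolding local_metric_generator_def by blast
      \<comment> \<open>The second coordinates agree and contribute 0, so only the distances in
        \<open>G\<close> remain.\<close>
      then have "gdist P (s, b) (a, b) \<noteq> gdist P (s, b) (c, d)"
        using v SG True by (auto simp: gdist_strong_product H.gdist_self)
      then show ?thesis using s v by blast
    next
      case False
      then have "b \<rightarrow>\<^bsub>H\<^esub> d" using adj by (auto simp: strong_product_def)
      then obtain w where w: "w \<in> pverts H"
        "(gdist H d w \<ge> k \<and> b \<in> interval H d w) \<or> (gdist H b w \<ge> k \<and> d \<in> interval H b w)"
        using k(2) unfolding adjacency_resolved_def by blast
      obtain s where "s \<in> S" using S by blast
      then have "gdist P (s, w) (a, b) \<noteq> gdist P (s, w) (c, d)"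
        using w v False resolve[of s w a b c d] resolve[of s w c d a b] by metis
      then show ?thesis using w \<open>s \<in> S\<close> by blast
    qed
  qed
  then show ?thesis using SG by (auto simp: local_metric_generator_def pverts_P)
qed

section \<open>Lower bound, by counting the generator in fibres over the vertices of
  \<open>H\<close>\<close>

lemma card_local_metric_generator_ge:
  assumes "local_metric_generator P S"
  shows "card (pverts H) * (card (pverts G) - card (true_twin_classes G)) \<le> card S"
proof -
  define F where "F b = {a. (a, b) \<in> S}" for b
  have S: "S \<subseteq> pverts G \<times> pverts H"
    using assms by (simp add: local_metric_generator_def pverts_P)
  then have FG: "F b \<subseteq> pverts G" for b by (auto simp: F_def)
  then have finF: "finite (F b)" for b using finite_subset G.pair_finite_verts by blast
  have fibre: "card (pverts G) - card (true_twin_classes G) \<le> card (F b)" if b: "b \<in> pverts H" for b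
  proof -
    \<comment> \<open>Two omitted vertices in one class would give adjacent true twins of
      \<open>P\<close> outside \<open>S\<close>, which \<open>S\<close> could not resolve. So at
      most one vertex per class is omitted.\<close>
    have "inj_on (\<lambda>a. true_twin_rel G `` {a}) (pverts G - F b)"
    proof (rule inj_onI, rule ccontr)
      fix a c
      assume ac: "a \<in> pverts G - F b" "c \<in> pverts G - F b" "a \<noteq> c"
        and "true_twin_rel G `` {a} = true_twin_rel G `` {c}"
      then have twins: "closed_nbhd G a = closed_nbhd G c"
        using closed_nbhd_eq_if_true_twin_class_eq[of a G c] by simp
      moreover have "c \<in> closed_nbhd G c" by (simp add: closed_nbhd_def)
      ultimately have "c \<in> closed_nbhd G a" by simp
      then have "(a, b) \<rightarrow>\<^bsub>P\<^esub> (c, b)"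
        using ac b by (auto simp: closed_nbhd_def strong_product_def)
      then obtain s where s: "s \<in> S" "gdist P s (a, b) \<noteq> gdist P s (c, b)"
        using assms unfolding local_metric_generator_def by blast
      obtain e f where ef: "s = (e, f)" "e \<in> pverts G" "f \<in> pverts H" using s S by auto
      have "closed_nbhd P (a, b) = closed_nbhd P (c, b)"
        using ac b twins by (simp add: closed_nbhd_strong_product)
      moreover have "s \<rightarrow>\<^sup>*\<^bsub>P\<^esub> (a, b)" "s \<rightarrow>\<^sup>*\<^bsub>P\<^esub> (c, b)"
        using ef ac b by (simp_all add: reachable_strong_product)
      ultimately have "s = (a, b) \<or> s = (c, b)"
        using P.true_twins_resolved_only_by_themselves s by blast
      then show False using s ac by (auto simp: F_def)
    qed
    moreover have "(\<lambda>a. true_twin_rel G `` {a}) ` (pverts G - F b) \<subseteq> true_twin_classes G"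
      by (auto simp: true_twin_classes_def intro: quotientI)
    moreover have "finite (true_twin_classes G)"
      by (simp add: true_twin_classes_def quotient_def)
    ultimately have "card (pverts G - F b) \<le> card (true_twin_classes G)"
      by (rule card_inj_on_le)
    then show ?thesis using card_Diff_subset[OF finF FG, of b] by simp
  qed
  have "card (pverts H) * (card (pverts G) - card (true_twin_classes G))
      \<le> (\<Sum>b\<in>pverts H. card (F b))"
    using sum_bounded_below[OF fibre] by simp
  also have "\<dots> = card (SIGMA b : pverts H. F b)" using finF by simp
  \<comment> \<open>The sum indexes pairs by their \<open>H\<close>-coordinate first, whereas
    \<open>S\<close> has it second.\<close>
  also have "\<dots> = card (prod.swap ` (SIGMA b : pverts H. F b))"
    by (simp add: card_image)
  also have "prod.swap ` (SIGMA b : pverts H. F b) = S" using S by (auto simp: F_def image_iff)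
  finally show ?thesis .
qed

end

theorem theorem13:
  fixes G :: "'a pair_pre_digraph" and H :: "'b pair_pre_digraph" and k n1 n2 t1 :: nat
  assumes "pair_graph G" and "Digraph_Component.connected (with_proj G)"
    and "pair_graph H" and "Digraph_Component.connected (with_proj H)"
    and "card (pverts H) = n2" and "adjacency_resolved k H"
    and "card (pverts G) = n1" and "n1 \<ge> 2"
    and "card (true_twin_classes G) = t1"
    and "diameter G < k"
    and "local_metric_dim G = n1 - t1"
  shows "local_metric_dim (strong_product G H) = n2 * (n1 - t1)"
proof (rule antisym)
  interpret strong_product_graphs G H
    using assms by (simp add: strong_product_graphs_def strong_product_graphs_axioms_def)
  obtain S where S: "local_metric_generator G S" "card S = n1 - t1"
    using G.obtain_local_metric_basis assms by metis
  \<comment> \<open>An edge of the product whose \<open>H\<close>-coordinates differ is resolved by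
    a vertex \<open>(s, w)\<close> with arbitrary \<open>s\<close> in \<open>S\<close>, so such an
    \<open>s\<close> must exist.\<close>
  moreover have "S \<noteq> {}"
    using S assms G.local_metric_generator_nonempty by blast
  ultimately have "local_metric_generator P (S \<times> pverts H)"
    using assms by (intro local_metric_generator_Times)
  from local_metric_dim_le[OF this] show "local_metric_dim P \<le> n2 * (n1 - t1)"
    using S assms by (simp add: card_cartesian_product mult.commute)
  obtain T where "local_metric_generator P T" "card T = local_metric_dim P"
    using P.obtain_local_metric_basis[OF connected_strong_product] by blast
  then show "n2 * (n1 - t1) \<le> local_metric_dim P"
    using card_local_metric_generator_ge assms by metis
qed

end
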